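(* Let $\mathbf{P}\colon\mathsf{C}^{\mathrm{op}}\to\mathsf{BA}$ be a Boolean doctrine with $\mathsf{C}$ small. Let $\bar i,\bar j\in\mathbb{N}$, $S,Y_1,\dots,Y_{\bar i},Z_1,\dots,Z_{\bar j}\in\mathsf{C}$, $\alpha_i\in\mathbf{P}(S\times Y_i)$ ($i=1,\dots,\bar i$), $\beta_j\in\mathbf{P}(S\times Z_j)$ ($j=1,\dots,\bar j$). The following are equivalent: (1) for every propositional model $(M,\mathfrak{m},s)$ of $\mathbf{P}$ at $S$, if for every $i\in\{1,\dots,\bar i\}$ and every $y\in M(Y_i)$ we have $(s,y)\in\mathfrak{m}_{S\times Y_i}(\alpha_i)$, then there is $j\in\{1,\dots,\bar j\}$ such that for every $z\in M(Z_j)$, $(s,z)\in\mathfrak{m}_{S\times Z_j}(\beta_j)$; (2) there are $n\in\mathbb{N}$, $l_1,\dots,l_n\in\{1,\dots,\bar i\}$ and morphisms $g_i\colon S\times\prod_{j=1}^{\bar j}Z_j\to Y_{l_i}$ ($i=1,\dots,n$) such that in $\mathbf{P}(S\times\prod_{j=1}^{\bar j}Z_j)$, $\bigwedge_{i=1}^n\mathbf{P}(\langle\mathrm{pr}_1,g_i\rangle)(\alpha_{l_i})\le\bigvee_{j=1}^{\bar j}\mathbf{P}(\langle\mathrm{pr}_1,\mathrm{pr}_{j+1}\rangle)(\beta_j)$.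
   Context: Categories have finite products; $\mathrm{pr}_k$ is the $k$-th projection, $\langle f,g\rangle$ the induced morphism into a product. A Boolean doctrine over $\mathsf{C}$ is a functor $\mathbf{P}\colon\mathsf{C}^{\mathrm{op}}\to\mathsf{BA}$. The subsets doctrine $\mathscr{P}\colon\mathsf{Set}^{\mathrm{op}}\to\mathsf{BA}$ sends a set to its power set and a function to preimage. A propositional model of $\mathbf{P}$ is a pair $(M,\mathfrak{m})$ with $M\colon\mathsf{C}\to\mathsf{Set}$ finite-product-preserving and $\mathfrak{m}\colon\mathbf{P}\Rightarrow\mathscr{P}\circ M^{\mathrm{op}}$ natural. A propositional model of $\mathbf{P}$ at $S$ is a triple $(M,\mathfrak{m},s)$ with $(M,\mathfrak{m})$ a propositional model of $\mathbf{P}$ and $s\in M(S)$; $M(S\times Y)$ is identified with $M(S)\times M(Y)$. *)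

theory Defs
  imports "HOL-Algebra.Complete_Lattice"
begin

section \<open>Categories with finite products\<close>

record ('o, 'm) category =
  Ob :: "'o set"
  Arr :: "'m set"
  Dom :: "'m \<Rightarrow> 'o"
  Cod :: "'m \<Rightarrow> 'o"
  Idt :: "'o \<Rightarrow> 'm"
  Cmp :: "'m \<Rightarrow> 'm \<Rightarrow> 'm" (infixl \<open>\<cdot>\<index>\<close> 70)

definition Mor :: "('o, 'm, 'x) category_scheme \<Rightarrow> 'o \<Rightarrow> 'o \<Rightarrow> 'm set" where
  "Mor C X Y = {f \<in> Arr C. Dom C f = X \<and> Cod C f = Y}"

locale category =
  fixes C (structure)
  assumes Dom_in_Ob: "f \<in> Arr C \<Longrightarrow> Dom C f \<in> Ob C"
    and Cod_in_Ob: "f \<in> Arr C \<Longrightarrow> Cod C f \<in> Ob C"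
    and Idt_in_Mor: "X \<in> Ob C \<Longrightarrow> Idt C X \<in> Mor C X X"
    and Cmp_in_Mor: "f \<in> Mor C X Y \<Longrightarrow> g \<in> Mor C Y Z \<Longrightarrow> g \<cdot> f \<in> Mor C X Z"
    and Cmp_Idt: "f \<in> Mor C X Y \<Longrightarrow> f \<cdot> Idt C X = f"
    and Idt_Cmp: "f \<in> Mor C X Y \<Longrightarrow> Idt C Y \<cdot> f = f"
    and Cmp_assoc: "f \<in> Mor C X Y \<Longrightarrow> g \<in> Mor C Y Z \<Longrightarrow> h \<in> Mor C Z W \<Longrightarrow>
      (h \<cdot> g) \<cdot> f = h \<cdot> (g \<cdot> f)"

definition is_product ::
  "('o, 'm, 'x) category_scheme \<Rightarrow> 'o list \<Rightarrow> 'o \<Rightarrow> (nat \<Rightarrow> 'm) \<Rightarrow> bool" where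
  "is_product C Xs A p \<longleftrightarrow>
    set Xs \<subseteq> Ob C \<and> A \<in> Ob C \<and> (\<forall>k<length Xs. p k \<in> Mor C A (Xs ! k)) \<and>
    (\<forall>B\<in>Ob C. \<forall>f. (\<forall>k<length Xs. f k \<in> Mor C B (Xs ! k)) \<longrightarrow>
      (\<exists>!h. h \<in> Mor C B A \<and> (\<forall>k<length Xs. p k \<cdot>\<^bsub>C\<^esub> h = f k)))"

text \<open>
  A choice of a product of every finite list of objects; the empty list gives a terminal object.
  \<^term>\<open>Pr C Xs k\<close> is the projection onto \<^term>\<open>Xs ! k\<close>, so projections are counted from 0.
\<close>

record ('o, 'm) fp_category = "('o, 'm) category" +
  Prd :: "'o list \<Rightarrow> 'o"
  Pr :: "'o list \<Rightarrow> nat \<Rightarrow> 'm"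

locale fp_category = category C for C (structure) +
  assumes Prd_is_product: "set Xs \<subseteq> Ob C \<Longrightarrow> is_product C Xs (Prd C Xs) (Pr C Xs)"

definition pairing :: "('o, 'm, 'x) fp_category_scheme \<Rightarrow> 'm \<Rightarrow> 'm \<Rightarrow> 'm" where
  "pairing C f g =
    (THE h. h \<in> Mor C (Dom C f) (Prd C [Cod C f, Cod C g]) \<and>
      Pr C [Cod C f, Cod C g] 0 \<cdot>\<^bsub>C\<^esub> h = f \<and> Pr C [Cod C f, Cod C g] 1 \<cdot>\<^bsub>C\<^esub> h = g)"

text \<open>
  HOL has no type of all sets. Here the objects of the category of sets are the subsets of a type
  \<open>'u\<close>, and a category is small if its arrows (hence also its objects, via the
  identities) form a set of that size.
\<close>

definition small :: "'u itself \<Rightarrow> ('o, 'm, 'x) category_scheme \<Rightarrow> bool" where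
  "small _ C \<longleftrightarrow> (\<exists>\<iota> :: 'm \<Rightarrow> 'u. inj_on \<iota> (Arr C))"


section \<open>Boolean algebras\<close>

locale boolean_lattice = bounded_lattice L for L (structure) +
  assumes meet_join_distrib:
    "x \<in> carrier L \<Longrightarrow> y \<in> carrier L \<Longrightarrow> z \<in> carrier L \<Longrightarrow>
      x \<sqinter> (y \<squnion> z) = (x \<sqinter> y) \<squnion> (x \<sqinter> z)"
    and complement_exists:
    "x \<in> carrier L \<Longrightarrow> \<exists>y\<in>carrier L. x \<sqinter> y = \<bottom> \<and> x \<squnion> y = \<top>"

text \<open>
  Complements are unique, so a map preserving the bounded lattice structure preserves them
  as well.
\<close>

definition boolean_hom ::
  "('a, 'x) gorder_scheme \<Rightarrow> ('b, 'y) gorder_scheme \<Rightarrow> ('a \<Rightarrow> 'b) \<Rightarrow> bool" where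
  "boolean_hom L K h \<longleftrightarrow>
    boolean_lattice L \<and> boolean_lattice K \<and> h \<in> carrier L \<rightarrow> carrier K \<and>
    meet_pres L K h \<and> join_pres L K h \<and> h \<bottom>\<^bsub>L\<^esub> = \<bottom>\<^bsub>K\<^esub> \<and> h \<top>\<^bsub>L\<^esub> = \<top>\<^bsub>K\<^esub>"

lemma boolean_lattice_complement_unique:
  assumes "boolean_lattice L"
    and xyz: "x \<in> carrier L" "y \<in> carrier L" "z \<in> carrier L"
    and y: "x \<sqinter>\<^bsub>L\<^esub> y = \<bottom>\<^bsub>L\<^esub>" "x \<squnion>\<^bsub>L\<^esub> y = \<top>\<^bsub>L\<^esub>"
    and z: "x \<sqinter>\<^bsub>L\<^esub> z = \<bottom>\<^bsub>L\<^esub>" "x \<squnion>\<^bsub>L\<^esub> z = \<top>\<^bsub>L\<^esub>"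
  shows "y = z"
proof -
  interpret boolean_lattice L by fact
  have top: "u \<sqinter>\<^bsub>L\<^esub> \<top>\<^bsub>L\<^esub> = u" if "u \<in> carrier L" for u
    using top_meet[OF that] by (simp add: eq_is_equal meet_comm)
  have "y = y \<sqinter>\<^bsub>L\<^esub> (x \<squnion>\<^bsub>L\<^esub> z)" using z(2) top xyz by simp
  also have "\<dots> = (y \<sqinter>\<^bsub>L\<^esub> x) \<squnion>\<^bsub>L\<^esub> (y \<sqinter>\<^bsub>L\<^esub> z)" using meet_join_distrib xyz by blast
  also have "\<dots> = (z \<sqinter>\<^bsub>L\<^esub> x) \<squnion>\<^bsub>L\<^esub> (z \<sqinter>\<^bsub>L\<^esub> y)" using y z by (metis meet_comm)
  also have "\<dots> = z \<sqinter>\<^bsub>L\<^esub> (x \<squnion>\<^bsub>L\<^esub> y)" using meet_join_distrib xyz by metis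
  also have "\<dots> = z" using y(2) top xyz by simp
  finally show ?thesis .
qed

lemma powerset_meet:
  assumes "X \<subseteq> A" "Y \<subseteq> A"
  shows "X \<sqinter>\<^bsub>\<lparr>carrier = Pow A, eq = (=), le = (\<subseteq>)\<rparr>\<^esub> Y = X \<inter> Y"
    (is "_ \<sqinter>\<^bsub>?L\<^esub> _ = _")
proof -
  have L: "Lower ?L {X, Y} = Pow (X \<inter> Y)" using assms by (auto simp: Lower_def)
  show ?thesis unfolding meet_def Lattice.inf_def L greatest_def using assms
    by (intro some_equality conjI subset_antisym) auto
qed

lemma powerset_join:
  assumes "X \<subseteq> A" "Y \<subseteq> A"
  shows "X \<squnion>\<^bsub>\<lparr>carrier = Pow A, eq = (=), le = (\<subseteq>)\<rparr>\<^esub> Y = X \<union> Y"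
    (is "_ \<squnion>\<^bsub>?L\<^esub> _ = _")
proof -
  have L: "Upper ?L {X, Y} = {U. X \<union> Y \<subseteq> U \<and> U \<subseteq> A}" using assms by (auto simp: Upper_def)
  show ?thesis unfolding join_def Lattice.sup_def L least_def using assms
    by (intro some_equality conjI subset_antisym) auto
qed

lemma powerset_bottom: "\<bottom>\<^bsub>\<lparr>carrier = Pow A, eq = (=), le = (\<subseteq>)\<rparr>\<^esub> = {}"
  unfolding bottom_def least_def by (intro some_equality) auto

lemma powerset_top: "\<top>\<^bsub>\<lparr>carrier = Pow A, eq = (=), le = (\<subseteq>)\<rparr>\<^esub> = A"
  unfolding top_def greatest_def by (intro some_equality) auto

lemma powerset_boolean_lattice: "boolean_lattice \<lparr>carrier = Pow A, eq = (=), le = (\<subseteq>)\<rparr>" (is "boolean_lattice ?L")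
proof (intro boolean_lattice.intro boolean_lattice_axioms.intro)
  interpret complete_lattice ?L by (rule powerset_is_complete_lattice)
  show "bounded_lattice ?L" ..
next
  fix x y z assume "x \<in> carrier ?L" "y \<in> carrier ?L" "z \<in> carrier ?L"
  then have s: "x \<subseteq> A" "y \<subseteq> A" "z \<subseteq> A" by auto
  then have s': "y \<union> z \<subseteq> A" "x \<inter> y \<subseteq> A" "x \<inter> z \<subseteq> A" by auto
  show "x \<sqinter>\<^bsub>?L\<^esub> (y \<squnion>\<^bsub>?L\<^esub> z) = x \<sqinter>\<^bsub>?L\<^esub> y \<squnion>\<^bsub>?L\<^esub> (x \<sqinter>\<^bsub>?L\<^esub> z)"
    unfolding powerset_meet[OF s(1,2)] powerset_meet[OF s(1,3)] powerset_join[OF s(2,3)]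
      powerset_meet[OF s(1) s'(1)] powerset_join[OF s'(2,3)]
    by (rule Int_Un_distrib)
next
  fix x assume "x \<in> carrier ?L"
  then have x: "x \<subseteq> A" by simp
  have "A - x \<in> carrier ?L" "x \<inter> (A - x) = {}" "x \<union> (A - x) = A" using x by auto
  with powerset_meet[OF x Diff_subset[of A x]] powerset_join[OF x Diff_subset[of A x]]
  show "\<exists>y\<in>carrier ?L. x \<sqinter>\<^bsub>?L\<^esub> y = \<bottom>\<^bsub>?L\<^esub> \<and> x \<squnion>\<^bsub>?L\<^esub> y = \<top>\<^bsub>?L\<^esub>"
    unfolding powerset_bottom powerset_top by (intro bexI[of _ "A - x"] conjI) (simp_all only:)
qed


section \<open>Boolean doctrines\<close>

record ('o, 'm, 'b) doctrine =
  Fib :: "'o \<Rightarrow> 'b gorder"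
  Rdx :: "'m \<Rightarrow> 'b \<Rightarrow> 'b"

locale boolean_doctrine = fp_category C for C (structure) +
  fixes P :: "('o, 'm, 'b) doctrine"
  assumes Fib_boolean: "X \<in> Ob C \<Longrightarrow> boolean_lattice (Fib P X)"
    and Rdx_hom: "f \<in> Mor C X Y \<Longrightarrow> boolean_hom (Fib P Y) (Fib P X) (Rdx P f)"
    and Rdx_Idt: "X \<in> Ob C \<Longrightarrow> a \<in> carrier (Fib P X) \<Longrightarrow> Rdx P (Idt C X) a = a"
    and Rdx_Cmp: "f \<in> Mor C X Y \<Longrightarrow> g \<in> Mor C Y Z \<Longrightarrow> a \<in> carrier (Fib P Z) \<Longrightarrow>
      Rdx P (g \<cdot> f) a = Rdx P f (Rdx P g a)"


section \<open>Propositional models\<close>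

record ('o, 'm, 'u) set_functor =
  FOb :: "'o \<Rightarrow> 'u set"
  FAr :: "'m \<Rightarrow> 'u \<Rightarrow> 'u"

locale set_functor = category C for C (structure) +
  fixes M :: "('o, 'm, 'u) set_functor"
  assumes FAr_fun: "f \<in> Mor C X Y \<Longrightarrow> FAr M f \<in> FOb M X \<rightarrow> FOb M Y"
    and FAr_Idt: "X \<in> Ob C \<Longrightarrow> x \<in> FOb M X \<Longrightarrow> FAr M (Idt C X) x = x"
    and FAr_Cmp: "f \<in> Mor C X Y \<Longrightarrow> g \<in> Mor C Y Z \<Longrightarrow> x \<in> FOb M X \<Longrightarrow>
      FAr M (g \<cdot> f) x = FAr M g (FAr M f x)"

definition preserves_finite_products ::
  "('o, 'm, 'x) category_scheme \<Rightarrow> ('o, 'm, 'u) set_functor \<Rightarrow> bool" where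
  "preserves_finite_products C M \<longleftrightarrow>
    (\<forall>Xs A p. is_product C Xs A p \<longrightarrow>
      bij_betw (\<lambda>x. map (\<lambda>k. FAr M (p k) x) [0..<length Xs])
        (FOb M A) (listset (map (FOb M) Xs)))"

text \<open>The composite of the subsets doctrine with \<^term>\<open>M\<close>.\<close>

definition subsets_doctrine ::
  "('o, 'm, 'x) category_scheme \<Rightarrow> ('o, 'm, 'u) set_functor \<Rightarrow> ('o, 'm, 'u set) doctrine" where
  "subsets_doctrine C M =
    \<lparr>Fib = (\<lambda>X. \<lparr>carrier = Pow (FOb M X), eq = (=), le = (\<subseteq>)\<rparr>),
     Rdx = (\<lambda>f B. {x \<in> FOb M (Dom C f). FAr M f x \<in> B})\<rparr>"

lemma subsets_doctrine_boolean:
  fixes M :: "('o, 'm, 'e) set_functor"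
  assumes "fp_category C" and "set_functor C M"
  shows "boolean_doctrine C (subsets_doctrine C M)"
proof -
  interpret fp_category C by fact
  interpret set_functor C M by fact
  have pre: "{x \<in> FOb M X. FAr M f x \<in> B} \<subseteq> FOb M X" for X f B by auto
  show ?thesis
  proof (intro boolean_doctrine.intro boolean_doctrine_axioms.intro assms(1), goal_cases)
    case (1 X)
    then show ?case by (simp add: subsets_doctrine_def powerset_boolean_lattice)
  next
    case (2 f X Y)
    then have f: "Dom C f = X" "FAr M f \<in> FOb M X \<rightarrow> FOb M Y"
      using FAr_fun by (auto simp: Mor_def)
    have l: "lattice \<lparr>carrier = Pow A, eq = (=), le = (\<subseteq>)\<rparr>" for A :: "'e set"
      using powerset_boolean_lattice boolean_lattice.axioms(1) bounded_lattice.axioms(1) by blast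
    show ?case
      unfolding boolean_hom_def meet_pres_def join_pres_def subsets_doctrine_def doctrine.simps
        f(1) partial_object.simps powerset_bottom powerset_top
    proof (intro conjI ballI powerset_boolean_lattice l)
      fix x y assume "x \<in> Pow (FOb M Y)" "y \<in> Pow (FOb M Y)"
      then show "{w \<in> FOb M X. FAr M f w \<in> x \<sqinter>\<^bsub>\<lparr>carrier = Pow (FOb M Y), eq = (=), le = (\<subseteq>)\<rparr>\<^esub> y} =
          {w \<in> FOb M X. FAr M f w \<in> x} \<sqinter>\<^bsub>\<lparr>carrier = Pow (FOb M X), eq = (=), le = (\<subseteq>)\<rparr>\<^esub>
          {w \<in> FOb M X. FAr M f w \<in> y}"
        and "{w \<in> FOb M X. FAr M f w \<in> x \<squnion>\<^bsub>\<lparr>carrier = Pow (FOb M Y), eq = (=), le = (\<subseteq>)\<rparr>\<^esub> y} =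
          {w \<in> FOb M X. FAr M f w \<in> x} \<squnion>\<^bsub>\<lparr>carrier = Pow (FOb M X), eq = (=), le = (\<subseteq>)\<rparr>\<^esub>
          {w \<in> FOb M X. FAr M f w \<in> y}"
        unfolding powerset_meet[OF pre pre] powerset_join[OF pre pre]
        by (auto simp: powerset_meet powerset_join)
    qed (use f(2) in auto)
  next
    case (3 X a)
    then show ?case
      using Idt_in_Mor[OF 3(1)] FAr_Idt by (auto simp: subsets_doctrine_def Mor_def)
  next
    case (4 f X Y g Z a)
    then have "Dom C (g \<cdot>\<^bsub>C\<^esub> f) = X" "Dom C f = X" "Dom C g = Y" "FAr M f \<in> FOb M X \<rightarrow> FOb M Y"
      using Cmp_in_Mor[of f X Y g Z] FAr_fun by (auto simp: Mor_def)
    with 4 show ?case by (auto simp: subsets_doctrine_def FAr_Cmp)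
  qed
qed

definition doctrine_nat_trans ::
  "('o, 'm, 'x) category_scheme \<Rightarrow> ('o, 'm, 'b) doctrine \<Rightarrow> ('o, 'm, 'd) doctrine \<Rightarrow>
    ('o \<Rightarrow> 'b \<Rightarrow> 'd) \<Rightarrow> bool" where
  "doctrine_nat_trans C P Q m \<longleftrightarrow>
    (\<forall>X\<in>Ob C. boolean_hom (Fib P X) (Fib Q X) (m X)) \<and>
    (\<forall>X Y. \<forall>f\<in>Mor C X Y. \<forall>a\<in>carrier (Fib P Y). m X (Rdx P f a) = Rdx Q f (m Y a))"

definition propositional_model ::
  "('o, 'm, 'x) category_scheme \<Rightarrow> ('o, 'm, 'b) doctrine \<Rightarrow>
    ('o, 'm, 'u) set_functor \<Rightarrow> ('o \<Rightarrow> 'b \<Rightarrow> 'u set) \<Rightarrow> bool" where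
  "propositional_model C P M m \<longleftrightarrow>
    set_functor C M \<and> preserves_finite_products C M \<and>
    doctrine_nat_trans C P (subsets_doctrine C M) m"

definition propositional_model_at ::
  "('o, 'm, 'x) category_scheme \<Rightarrow> ('o, 'm, 'b) doctrine \<Rightarrow> 'o \<Rightarrow>
    ('o, 'm, 'u) set_functor \<Rightarrow> ('o \<Rightarrow> 'b \<Rightarrow> 'u set) \<Rightarrow> 'u \<Rightarrow> bool" where
  "propositional_model_at C P S M m s \<longleftrightarrow> propositional_model C P M m \<and> s \<in> FOb M S"

text \<open>
  The element of \<open>M (S \<times> Y)\<close> that corresponds to \<open>(s, y)\<close> under the
  bijection of \<open>M (S \<times> Y)\<close> with \<open>M S \<times> M Y\<close>.
\<close>

definition model_pair ::
  "('o, 'm, 'x) fp_category_scheme \<Rightarrow> ('o, 'm, 'u) set_functor \<Rightarrow> 'o \<Rightarrow> 'o \<Rightarrow> 'u \<Rightarrow> 'u \<Rightarrow> 'u" where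
  "model_pair C M S Y s y =
    the_inv_into (FOb M (Prd C [S, Y]))
      (\<lambda>w. (FAr M (Pr C [S, Y] 0) w, FAr M (Pr C [S, Y] 1) w)) (s, y)"

end

theory Submission
  imports Defs
begin

text \<open>
  Let \<open>A = S \<times> Z\<^sub>1 \<times> \<dots> \<times> Z\<^sub>J\<close>. A prime filter \<open>U\<close> of \<open>P A\<close> makes the representable functor
  \<open>Hom(A, -)\<close> a propositional model, in which \<open>f : A \<rightarrow> X\<close> belongs to the interpretation of
  \<open>a \<in> P X\<close> iff \<open>P f a \<in> U\<close>; the point at \<open>S\<close> is the first projection. If no finite meet of
  instances of the \<open>\<alpha>\<^sub>i\<close> lies below the join of the generic instances of the \<open>\<beta>\<^sub>j\<close>, the prime
  filter theorem gives a \<open>U\<close> containing all the former and none of the latter, and in the resulting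
  model the remaining projections are counterexamples to every \<open>\<beta>\<^sub>j\<close>. Conversely, counterexamples
  in any model form a point of \<open>M A\<close>, and the elements of \<open>P A\<close> that hold at a point form a
  prime filter.
\<close>

section \<open>Finite meets and joins in a bounded lattice\<close>

text \<open>Every element is a lower bound of the empty set. This case and its dual serve
  \<open>n = 0\<close> and \<open>J = 0\<close> in the theorem.\<close>

lemma (in bounded_lattice) inf_empty: "\<Sqinter>{} = \<top>"
  by (simp add: Lattice.inf_def top_def)

lemma (in bounded_lattice) sup_empty: "\<Squnion>{} = \<bottom>"
  by (simp add: Lattice.sup_def bottom_def)

lemma (in bounded_lattice) finite_inf_is_glb:
  assumes "finite A" "A \<subseteq> carrier L"
  shows "greatest L (\<Sqinter>A) (Lower L A)"
  using assms finite_inf_greatest top_greatest by (cases "A = {}") (auto simp: inf_empty)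

lemma (in bounded_lattice) finite_sup_is_lub:
  assumes "finite A" "A \<subseteq> carrier L"
  shows "least L (\<Squnion>A) (Upper L A)"
  using assms finite_sup_least bottom_least by (cases "A = {}") (auto simp: sup_empty)

text \<open>The sets \<open>{x, \<Sqinter>A}\<close> and \<open>insert x A\<close> have the same
  lower bounds, hence the same greatest one. This drives the inductions over finite sets
  below.\<close>

lemma (in bounded_lattice) inf_insert:
  assumes "finite A" "A \<subseteq> carrier L" "x \<in> carrier L"
  shows "\<Sqinter>(insert x A) = x \<sqinter> \<Sqinter>A"
proof -
  note A = finite_inf_is_glb[OF assms(1,2)]
  have "l \<sqsubseteq> \<Sqinter>A \<longleftrightarrow> (\<forall>y\<in>A. l \<sqsubseteq> y)" if "l \<in> carrier L" for l
    using A assms(2) that greatest_Lower_below[OF A _ assms(2)] greatest_le[OF A] le_trans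
    by (meson Lower_memI greatest_closed subsetD)
  moreover have "l \<in> Lower L B \<longleftrightarrow> l \<in> carrier L \<and> (\<forall>y\<in>B. l \<sqsubseteq> y)" if "B \<subseteq> carrier L" for l B
    using that by (auto simp: Lower_def)
  ultimately have "Lower L {x, \<Sqinter>A} = Lower L (insert x A)"
    using assms greatest_closed[OF A] by (auto simp del: Lower_closed Upper_closed)
  with inf_of_two_greatest[OF assms(3) greatest_closed[OF A]]
  have "greatest L (x \<sqinter> \<Sqinter>A) (Lower L (insert x A))" by (simp add: meet_def)
  with finite_inf_is_glb[of "insert x A"] show ?thesis using assms by (simp add: greatest_unique)
qed

lemma (in bounded_lattice) sup_insert:
  assumes "finite A" "A \<subseteq> carrier L" "x \<in> carrier L"
  shows "\<Squnion>(insert x A) = x \<squnion> \<Squnion>A"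
proof -
  note A = finite_sup_is_lub[OF assms(1,2)]
  have "\<Squnion>A \<sqsubseteq> u \<longleftrightarrow> (\<forall>y\<in>A. y \<sqsubseteq> u)" if "u \<in> carrier L" for u
    using A assms(2) that least_Upper_above[OF A _ assms(2)] least_le[OF A] le_trans
    by (meson Upper_memI least_closed subsetD)
  moreover have "u \<in> Upper L B \<longleftrightarrow> u \<in> carrier L \<and> (\<forall>y\<in>B. y \<sqsubseteq> u)" if "B \<subseteq> carrier L" for u B
    using that by (auto simp: Upper_def)
  ultimately have "Upper L {x, \<Squnion>A} = Upper L (insert x A)"
    using assms least_closed[OF A] by (auto simp del: Lower_closed Upper_closed)
  with sup_of_two_least[OF assms(3) least_closed[OF A]]
  have "least L (x \<squnion> \<Squnion>A) (Upper L (insert x A))" by (simp add: join_def)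
  with finite_sup_is_lub[of "insert x A"] show ?thesis using assms by (simp add: least_unique)
qed

section \<open>Filters and the prime filter theorem\<close>

text \<open>The clauses say that the indicator function of \<open>U\<close> is a bounded lattice
  homomorphism to the two-element Boolean algebra; in this form they pull back along Boolean
  homomorphisms at once.\<close>

definition prime_filter :: "('a, 'x) gorder_scheme \<Rightarrow> 'a set \<Rightarrow> bool" where
  "prime_filter L U \<longleftrightarrow> U \<subseteq> carrier L \<and> \<top>\<^bsub>L\<^esub> \<in> U \<and> \<bottom>\<^bsub>L\<^esub> \<notin> U \<and>
    (\<forall>x\<in>carrier L. \<forall>y\<in>carrier L. (x \<sqinter>\<^bsub>L\<^esub> y \<in> U \<longleftrightarrow> x \<in> U \<and> y \<in> U) \<and>
      (x \<squnion>\<^bsub>L\<^esub> y \<in> U \<longleftrightarrow> x \<in> U \<or> y \<in> U))"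

lemma (in bounded_lattice) prime_filter_inf_iff:
  assumes "prime_filter L U" "finite A" "A \<subseteq> carrier L"
  shows "\<Sqinter>A \<in> U \<longleftrightarrow> A \<subseteq> U"
  using assms(2,3)
proof (induction rule: finite_induct)
  case (insert x A)
  with finite_inf_is_glb[of A] have "\<Sqinter>A \<in> carrier L" by auto
  with insert assms(1) show ?case by (simp add: inf_insert prime_filter_def)
qed (use assms(1) in \<open>simp add: inf_empty prime_filter_def\<close>)

lemma (in bounded_lattice) prime_filter_sup_iff:
  assumes "prime_filter L U" "finite A" "A \<subseteq> carrier L"
  shows "\<Squnion>A \<in> U \<longleftrightarrow> A \<inter> U \<noteq> {}"
  using assms(2,3)
proof (induction rule: finite_induct)
  case (insert x A)
  with finite_sup_is_lub[of A] have "\<Squnion>A \<in> carrier L" by auto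
  with insert assms(1) show ?case by (auto simp add: sup_insert prime_filter_def)
qed (use assms(1) in \<open>simp add: sup_empty prime_filter_def\<close>)

text \<open>Upward closure is contained in the meet clause, because \<open>x \<sqsubseteq> y\<close>
  means \<open>x = x \<sqinter> y\<close>.\<close>

lemma (in bounded_lattice) prime_filter_up:
  assumes "prime_filter L U" "x \<in> U" "y \<in> carrier L" "x \<sqsubseteq> y"
  shows "y \<in> U"
proof -
  have "x \<in> carrier L" using assms(1,2) by (auto simp: prime_filter_def)
  then have "x = x \<sqinter> y" using assms(3,4) le_iff_join by blast
  with assms(2) have "x \<sqinter> y \<in> U" by (rule subst[rotated])
  then show ?thesis using assms(1,3) \<open>x \<in> carrier L\<close> by (simp add: prime_filter_def)
qed

text \<open>The whole carrier is allowed; properness will come from avoiding a chosen element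
  \<open>b\<close>.\<close>

definition order_filter :: "('a, 'x) gorder_scheme \<Rightarrow> 'a set \<Rightarrow> bool" where
  "order_filter L F \<longleftrightarrow> F \<subseteq> carrier L \<and> \<top>\<^bsub>L\<^esub> \<in> F \<and> (\<forall>x\<in>F. \<forall>y\<in>F. x \<sqinter>\<^bsub>L\<^esub> y \<in> F) \<and>
    (\<forall>x\<in>F. \<forall>y\<in>carrier L. x \<sqsubseteq>\<^bsub>L\<^esub> y \<longrightarrow> y \<in> F)"

text \<open>If the finite sets \<open>A\<close> and \<open>B\<close> witness membership of
  \<open>x\<close> and \<open>y\<close>, then \<open>A \<union> B\<close> witnesses that of
  \<open>x \<sqinter> y\<close>; the empty set witnesses the top.\<close>

lemma (in bounded_lattice) order_filter_generated:
  assumes "G \<subseteq> carrier L"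
  shows "order_filter L {x \<in> carrier L. \<exists>A. finite A \<and> A \<subseteq> G \<and> \<Sqinter>A \<sqsubseteq> x}"
proof -
  have cl: "\<Sqinter>A \<in> carrier L" if "finite A" "A \<subseteq> G" for A
    using finite_inf_is_glb[of A] that assms by blast
  have "\<exists>A. finite A \<and> A \<subseteq> G \<and> \<Sqinter>A \<sqsubseteq> x \<sqinter> y"
    if x: "x \<in> carrier L" "finite A" "A \<subseteq> G" "\<Sqinter>A \<sqsubseteq> x"
      and y: "y \<in> carrier L" "finite B" "B \<subseteq> G" "\<Sqinter>B \<sqsubseteq> y" for x y A B
  proof (intro exI[of _ "A \<union> B"] conjI)
    have g: "greatest L (\<Sqinter>(A \<union> B)) (Lower L (A \<union> B))"
      using finite_inf_is_glb[of "A \<union> B"] that assms by blast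
    then have l: "\<Sqinter>(A \<union> B) \<in> Lower L (A \<union> B)" by (rule greatest_mem)
    then have "\<Sqinter>(A \<union> B) \<in> Lower L A" "\<Sqinter>(A \<union> B) \<in> Lower L B" by (auto simp: Lower_def)
    then have "\<Sqinter>(A \<union> B) \<sqsubseteq> \<Sqinter>A" "\<Sqinter>(A \<union> B) \<sqsubseteq> \<Sqinter>B"
      using finite_inf_is_glb[of A] finite_inf_is_glb[of B] that assms
      by (meson greatest_le subset_trans)+
    then have "\<Sqinter>(A \<union> B) \<sqsubseteq> x" "\<Sqinter>(A \<union> B) \<sqsubseteq> y"
      using cl[of A] cl[of B] cl[of "A \<union> B"] that by (meson le_trans Un_least finite_UnI)+
    then show "\<Sqinter>(A \<union> B) \<sqsubseteq> x \<sqinter> y"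
      using that cl[of "A \<union> B"] by (simp add: meet_le)
  qed (use that in auto)
  moreover have "\<exists>A. finite A \<and> A \<subseteq> G \<and> \<Sqinter>A \<sqsubseteq> \<top>"
    by (rule exI[of _ "{}"]) (simp add: inf_empty)
  moreover have "\<exists>A. finite A \<and> A \<subseteq> G \<and> \<Sqinter>A \<sqsubseteq> y"
    if "finite A" "A \<subseteq> G" "\<Sqinter>A \<sqsubseteq> x" "x \<sqsubseteq> y" "x \<in> carrier L" "y \<in> carrier L" for A x y
    using that cl by (meson le_trans)
  ultimately show ?thesis unfolding order_filter_def by auto
qed

text \<open>This is the filter generated by \<open>F\<close> and \<open>x\<close>. Witnesses
  \<open>f\<close> and \<open>g\<close> combine to \<open>f \<sqinter> g\<close>, since
  \<open>f \<sqinter> g \<sqinter> x\<close> lies below both \<open>f \<sqinter> x\<close> and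
  \<open>g \<sqinter> x\<close>.\<close>

lemma (in bounded_lattice) order_filter_insert:
  assumes "order_filter L F" "x \<in> carrier L"
  shows "order_filter L {z \<in> carrier L. \<exists>f\<in>F. f \<sqinter> x \<sqsubseteq> z}"
proof -
  have F: "F \<subseteq> carrier L" "\<top> \<in> F" using assms by (auto simp: order_filter_def)
  have "\<exists>h\<in>F. h \<sqinter> x \<sqsubseteq> z \<sqinter> w"
    if "z \<in> carrier L" "w \<in> carrier L" "f \<in> F" "f \<sqinter> x \<sqsubseteq> z" "g \<in> F" "g \<sqinter> x \<sqsubseteq> w" for z w f g
  proof
    show "f \<sqinter> g \<in> F" using assms that by (simp add: order_filter_def)
    have fg: "f \<in> carrier L" "g \<in> carrier L" using that F by auto
    let ?h = "f \<sqinter> g \<sqinter> x"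
    have "?h \<sqsubseteq> f" "?h \<sqsubseteq> g" "?h \<sqsubseteq> x"
      using fg assms(2) by (meson meet_closed meet_left meet_right le_trans)+
    then have "?h \<sqsubseteq> f \<sqinter> x" "?h \<sqsubseteq> g \<sqinter> x" using fg assms(2) by (simp_all add: meet_le)
    then have "?h \<sqsubseteq> z" "?h \<sqsubseteq> w" using fg assms(2) that by (meson meet_closed le_trans)+
    then show "?h \<sqsubseteq> z \<sqinter> w" using fg assms(2) that by (simp add: meet_le)
  qed
  moreover have "\<exists>f\<in>F. f \<sqinter> x \<sqsubseteq> \<top>" using F assms(2) by (intro bexI[of _ \<top>]) auto
  moreover have "\<exists>f\<in>F. f \<sqinter> x \<sqsubseteq> w"
    if "f \<in> F" "f \<sqinter> x \<sqsubseteq> z" "z \<sqsubseteq> w" "z \<in> carrier L" "w \<in> carrier L" for f z w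
    using that F assms(2) by (meson le_trans meet_closed subsetD)
  ultimately show ?thesis unfolding order_filter_def by auto
qed

text \<open>Primeness is where distributivity enters: if adding \<open>x\<close> or adding
  \<open>y\<close> to \<open>F\<close> forces \<open>b\<close>, then so does adding
  \<open>x \<squnion> y\<close>, which therefore cannot already lie in \<open>F\<close>.\<close>

lemma (in boolean_lattice) maximal_filter_prime:
  assumes F: "order_filter L F" "b \<notin> F" "b \<in> carrier L"
    and max: "\<And>F'. order_filter L F' \<Longrightarrow> F \<subseteq> F' \<Longrightarrow> b \<notin> F' \<Longrightarrow> F' = F"
  shows "prime_filter L F"
proof -
  have sub: "F \<subseteq> carrier L" and top: "\<top> \<in> F"
    and meet: "\<And>x y. x \<in> F \<Longrightarrow> y \<in> F \<Longrightarrow> x \<sqinter> y \<in> F"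
    and up: "\<And>x y. x \<in> F \<Longrightarrow> y \<in> carrier L \<Longrightarrow> x \<sqsubseteq> y \<Longrightarrow> y \<in> F"
    using F(1) by (auto simp: order_filter_def)
  \<comment> \<open>Otherwise the filter generated by \<open>F\<close> and \<open>x\<close> still
    avoids \<open>b\<close>, so by maximality it equals \<open>F\<close> and \<open>x\<close> lies
    in \<open>F\<close>.\<close>
  have ext: "\<exists>f\<in>F. f \<sqinter> x \<sqsubseteq> b" if x: "x \<in> carrier L" "x \<notin> F" for x
  proof (rule ccontr)
    let ?F = "{z \<in> carrier L. \<exists>f\<in>F. f \<sqinter> x \<sqsubseteq> z}"
    assume "\<not> (\<exists>f\<in>F. f \<sqinter> x \<sqsubseteq> b)"
    moreover have "F \<subseteq> ?F" using sub x meet_left by blast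
    ultimately have "?F = F" using max[OF order_filter_insert[OF F(1) x(1)]] by blast
    moreover have "x \<in> ?F" using top x meet_right[of \<top> x] by auto
    ultimately show False using x by blast
  qed
  have prime: "x \<in> F \<or> y \<in> F" if xy: "x \<in> carrier L" "y \<in> carrier L" "x \<squnion> y \<in> F" for x y
  proof (rule ccontr)
    assume "\<not> (x \<in> F \<or> y \<in> F)"
    then obtain f g where fg: "f \<in> F" "g \<in> F" and le: "f \<sqinter> x \<sqsubseteq> b" "g \<sqinter> y \<sqsubseteq> b"
      using ext xy by meson
    \<comment> \<open>A single element of \<open>F\<close> that works for both \<open>x\<close> and
      \<open>y\<close>, so that distributivity applies to its meet with
      \<open>x \<squnion> y\<close>.\<close>
    let ?h = "f \<sqinter> g"
    have c: "f \<in> carrier L" "g \<in> carrier L" "?h \<in> carrier L"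
      using fg sub meet by blast+
    have hf: "?h \<sqinter> x \<sqsubseteq> f \<sqinter> x" "?h \<sqinter> y \<sqsubseteq> g \<sqinter> y"
      using c xy by (meson meet_closed meet_left meet_right meet_le le_trans)+
    have "?h \<sqinter> x \<sqsubseteq> b" "?h \<sqinter> y \<sqsubseteq> b"
      using le_trans[OF hf(1) le(1)] le_trans[OF hf(2) le(2)] c xy F(3) by auto
    then have "?h \<sqinter> (x \<squnion> y) \<sqsubseteq> b" using c xy F(3) by (simp add: meet_join_distrib join_le)
    moreover have "?h \<sqinter> (x \<squnion> y) \<in> F" using meet fg xy by blast
    ultimately show False using up F by blast
  qed
  have "\<bottom> \<notin> F" using up[of \<bottom> b] F by auto
  moreover have "x \<sqinter> y \<in> F \<longleftrightarrow> x \<in> F \<and> y \<in> F" if "x \<in> carrier L" "y \<in> carrier L" for x y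
    using that up[OF _ _ meet_left] up[OF _ _ meet_right] meet by blast
  moreover have "x \<squnion> y \<in> F \<longleftrightarrow> x \<in> F \<or> y \<in> F" if "x \<in> carrier L" "y \<in> carrier L" for x y
    using that up[OF _ join_closed join_left] up[OF _ join_closed join_right] prime by blast
  ultimately show ?thesis
    unfolding prime_filter_def by (intro conjI ballI sub top) assumption
qed

text \<open>Zorn's lemma is applied to the filters that contain \<open>G\<close> and avoid
  \<open>b\<close>. The assumption \<open>sep\<close> says precisely that the filter generated by
  \<open>G\<close> is one of them, and a maximal one is prime.\<close>

lemma (in boolean_lattice) prime_filter_exists:
  assumes G: "G \<subseteq> carrier L" and b: "b \<in> carrier L"
    and sep: "\<And>A. finite A \<Longrightarrow> A \<subseteq> G \<Longrightarrow> \<not> \<Sqinter>A \<sqsubseteq> b"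
  obtains U where "prime_filter L U" "G \<subseteq> U" "b \<notin> U"
proof -
  let ?\<F> = "{F. order_filter L F \<and> G \<subseteq> F \<and> b \<notin> F}"
  let ?F = "{x \<in> carrier L. \<exists>A. finite A \<and> A \<subseteq> G \<and> \<Sqinter>A \<sqsubseteq> x}"
  have "G \<subseteq> ?F"
  proof
    fix x assume x: "x \<in> G"
    then have "\<Sqinter>{x} \<sqsubseteq> x"
      using G greatest_Lower_below[OF finite_inf_is_glb[of "{x}"]] by auto
    with x G show "x \<in> ?F" by blast
  qed
  with order_filter_generated[OF G] sep have "?F \<in> ?\<F>" by blast
  then have ne: "?\<F> \<noteq> {}" by blast
  have "\<exists>M\<in>?\<F>. \<forall>X\<in>?\<F>. M \<subseteq> X \<longrightarrow> X = M"
  proof (rule subset_Zorn_nonempty[OF ne])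
    fix \<C> assume \<C>: "\<C> \<noteq> {}" "subset.chain ?\<F> \<C>"
    then have el: "\<And>F. F \<in> \<C> \<Longrightarrow> order_filter L F \<and> G \<subseteq> F \<and> b \<notin> F"
      and ch: "\<And>F F'. F \<in> \<C> \<Longrightarrow> F' \<in> \<C> \<Longrightarrow> F \<subseteq> F' \<or> F' \<subseteq> F"
      unfolding subset_chain_def by blast+
    \<comment> \<open>Two elements of the union of a chain lie in a common member, which is closed
      under meets.\<close>
    have m: "x \<sqinter> y \<in> \<Union>\<C>" if xy: "F \<in> \<C>" "F' \<in> \<C>" "x \<in> F" "y \<in> F'" for x y F F'
    proof -
      obtain H where "H \<in> \<C>" "x \<in> H" "y \<in> H" using ch[OF xy(1,2)] xy by blast
      moreover from this have "x \<sqinter> y \<in> H" using el[of H] by (simp add: order_filter_def)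
      ultimately show ?thesis by blast
    qed
    have sub: "\<And>F. F \<in> \<C> \<Longrightarrow> F \<subseteq> carrier L" and top: "\<And>F. F \<in> \<C> \<Longrightarrow> \<top> \<in> F"
      and up: "\<And>F x y. F \<in> \<C> \<Longrightarrow> x \<in> F \<Longrightarrow> y \<in> carrier L \<Longrightarrow> x \<sqsubseteq> y \<Longrightarrow> y \<in> F"
      using el unfolding order_filter_def by blast+
    have "order_filter L (\<Union>\<C>)"
      unfolding order_filter_def
    proof (intro conjI ballI impI)
      show "\<Union>\<C> \<subseteq> carrier L" using sub by blast
      show "\<top> \<in> \<Union>\<C>" using top \<C>(1) by blast
      show "x \<sqinter> y \<in> \<Union>\<C>" if "x \<in> \<Union>\<C>" "y \<in> \<Union>\<C>" for x y using that m by blast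
      show "y \<in> \<Union>\<C>" if "x \<in> \<Union>\<C>" "y \<in> carrier L" "x \<sqsubseteq> y" for x y
        using that up by blast
    qed
    with el \<C>(1) show "\<Union>\<C> \<in> ?\<F>" by blast
  qed
  then obtain U where "U \<in> ?\<F>" and max: "\<forall>X\<in>?\<F>. U \<subseteq> X \<longrightarrow> X = U" by (rule bexE)
  then have U: "order_filter L U" "G \<subseteq> U" "b \<notin> U" by simp_all
  \<comment> \<open>Any filter above \<open>U\<close> contains \<open>G\<close>, so maximality
    within the Zorn family is maximality among all filters avoiding \<open>b\<close>.\<close>
  have "X = U" if "order_filter L X" "U \<subseteq> X" "b \<notin> X" for X
    using that U(2) max by simp
  with U b have "prime_filter L U" by (intro maximal_filter_prime[of U b])
  with U show ?thesis using that by simp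
qed

section \<open>Binary pairing and points of propositional models\<close>

lemma listset_iff_list_all2: "xs \<in> listset As \<longleftrightarrow> list_all2 (\<in>) xs As"
  by (induction As arbitrary: xs) (auto simp: set_Cons_def list_all2_Cons2)

lemma (in category) Mor_Ob: "f \<in> Mor C X Y \<Longrightarrow> X \<in> Ob C \<and> Y \<in> Ob C"
  using Dom_in_Ob Cod_in_Ob by (auto simp: Mor_def)

lemma (in fp_category) Pr_in_Mor:
  assumes "set Xs \<subseteq> Ob C" "k < length Xs"
  shows "Pr C Xs k \<in> Mor C (Prd C Xs) (Xs ! k)"
  using Prd_is_product[OF assms(1)] assms(2) by (simp add: is_product_def)

text \<open>The universal property of the product of the list \<open>[X, Y]\<close> makes the
  definite description in \<open>pairing\<close> well defined.\<close>

lemma (in fp_category)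
  assumes f: "f \<in> Mor C B X" and g: "g \<in> Mor C B Y"
  shows pairing_in_Mor: "pairing C f g \<in> Mor C B (Prd C [X, Y])"
    and Pr_0_pairing: "Pr C [X, Y] 0 \<cdot> pairing C f g = f"
    and Pr_1_pairing: "Pr C [X, Y] 1 \<cdot> pairing C f g = g"
proof -
  let ?Q = "\<lambda>h. h \<in> Mor C B (Prd C [X, Y]) \<and> Pr C [X, Y] 0 \<cdot> h = f \<and> Pr C [X, Y] 1 \<cdot> h = g"
  have ob: "B \<in> Ob C" "X \<in> Ob C" "Y \<in> Ob C" using Mor_Ob f g by auto
  have two: "(\<forall>k<length [X, Y]. R k) \<longleftrightarrow> R 0 \<and> R 1" for R
    by (auto simp: less_Suc_eq)
  have "is_product C [X, Y] (Prd C [X, Y]) (Pr C [X, Y])" using ob by (intro Prd_is_product) auto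
  then have "(\<forall>k<length [X, Y]. fs k \<in> Mor C B ([X, Y] ! k)) \<longrightarrow>
      (\<exists>!h. h \<in> Mor C B (Prd C [X, Y]) \<and> (\<forall>k<length [X, Y]. Pr C [X, Y] k \<cdot> h = fs k))" for fs
    using ob(1) unfolding is_product_def by blast
  \<comment> \<open>The universal property takes a family indexed by all naturals, of which only the
    values at 0 and 1 matter.\<close>
  from this[of "\<lambda>k. if k = 0 then f else g"] have "\<exists>!h. ?Q h"
    unfolding two using f g by simp
  then have "?Q (THE h. ?Q h)" by (rule theI')
  moreover have "(THE h. ?Q h) = pairing C f g"
    using f g by (simp add: pairing_def Mor_def)
  ultimately show "pairing C f g \<in> Mor C B (Prd C [X, Y])"
    "Pr C [X, Y] 0 \<cdot> pairing C f g = f" "Pr C [X, Y] 1 \<cdot> pairing C f g = g"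
    by simp_all
qed

text \<open>Both sides have the same two projections, and preservation of products makes the pair of
  projections injective on \<open>M\<close> of the product. The lemma turns statements about pairs
  into statements about the action of \<open>M\<close> on pairings.\<close>

lemma (in fp_category) model_pair_FAr:
  assumes M: "set_functor C M" "preserves_finite_products C M"
    and f: "f \<in> Mor C B X" and g: "g \<in> Mor C B Y" and w: "w \<in> FOb M B"
  shows "model_pair C M X Y (FAr M f w) (FAr M g w) = FAr M (pairing C f g) w"
proof -
  interpret set_functor C M by fact
  let ?Q = "Prd C [X, Y]" and ?p = "Pr C [X, Y]"
  have ob: "set [X, Y] \<subseteq> Ob C" using Mor_Ob f g by auto
  have "bij_betw (\<lambda>x. map (\<lambda>k. FAr M (?p k) x) [0..<length [X, Y]])
      (FOb M ?Q) (listset (map (FOb M) [X, Y]))"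
    using M(2) Prd_is_product[OF ob] unfolding preserves_finite_products_def by blast
  then have inj: "inj_on (\<lambda>w. (FAr M (?p 0) w, FAr M (?p 1) w)) (FOb M ?Q)"
    by (auto simp: bij_betw_def inj_on_def)
  have p: "?p 0 \<in> Mor C ?Q X" "?p 1 \<in> Mor C ?Q Y"
    using Pr_in_Mor[OF ob, of 0] Pr_in_Mor[OF ob, of 1] by simp_all
  note fg = pairing_in_Mor[OF f g]
  show ?thesis
    unfolding model_pair_def
  proof (rule the_inv_into_f_eq[OF inj])
    show "FAr M (pairing C f g) w \<in> FOb M ?Q" using FAr_fun[OF fg] w by auto
    show "(FAr M (?p 0) (FAr M (pairing C f g) w), FAr M (?p 1) (FAr M (pairing C f g) w)) =
        (FAr M f w, FAr M g w)"
      using FAr_Cmp[OF fg p(1) w] FAr_Cmp[OF fg p(2) w] Pr_0_pairing[OF f g] Pr_1_pairing[OF f g]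
      by simp
  qed
qed

text \<open>Membership of \<open>w\<close> is a homomorphism from the power set of
  \<open>FOb M A\<close> to the two-element algebra; it is composed here with the homomorphism
  \<open>m A\<close>.\<close>

lemma propositional_model_point_filter:
  assumes m: "propositional_model C P M m" and A: "A \<in> Ob C" and w: "w \<in> FOb M A"
  shows "prime_filter (Fib P A) {a \<in> carrier (Fib P A). w \<in> m A a}"
proof -
  let ?L = "Fib P A" and ?K = "\<lparr>carrier = Pow (FOb M A), eq = (=), le = (\<subseteq>)\<rparr>"
  have h: "boolean_hom ?L ?K (m A)"
    using m A unfolding propositional_model_def doctrine_nat_trans_def
    by (simp add: subsets_doctrine_def)
  interpret boolean_lattice ?L using h by (simp add: boolean_hom_def)
  have sub: "m A x \<subseteq> FOb M A" if "x \<in> carrier ?L" for x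
    using h that by (auto simp: boolean_hom_def)
  have "m A (x \<sqinter>\<^bsub>?L\<^esub> y) = m A x \<inter> m A y" "m A (x \<squnion>\<^bsub>?L\<^esub> y) = m A x \<union> m A y"
    if "x \<in> carrier ?L" "y \<in> carrier ?L" for x y
    using h that powerset_meet[OF sub sub, of x y] powerset_join[OF sub sub, of x y]
    by (simp_all add: boolean_hom_def meet_pres_def join_pres_def)
  moreover have "m A \<top>\<^bsub>?L\<^esub> = FOb M A" "m A \<bottom>\<^bsub>?L\<^esub> = {}"
    using h by (simp_all add: boolean_hom_def powerset_top powerset_bottom)
  ultimately show ?thesis using w by (auto simp: prime_filter_def)
qed

text \<open>Naturality read at one point, since reindexing of subsets is preimage.\<close>

lemma propositional_model_Rdx_iff:
  assumes m: "propositional_model C P M m" and f: "f \<in> Mor C A X"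
    and a: "a \<in> carrier (Fib P X)" and w: "w \<in> FOb M A"
  shows "w \<in> m A (Rdx P f a) \<longleftrightarrow> FAr M f w \<in> m X a"
proof -
  have "m A (Rdx P f a) = Rdx (subsets_doctrine C M) f (m X a)"
    using m f a unfolding propositional_model_def doctrine_nat_trans_def by blast
  then show ?thesis using f w by (simp add: subsets_doctrine_def Mor_def)
qed

section \<open>Representable functors as propositional models\<close>

text \<open>
  The hom-sets are transported along an embedding \<open>\<iota>\<close> of the arrows into the universe type,
  because functors into sets take values in subsets of that type.
\<close>

definition hom_functor ::
  "('o, 'm, 'x) category_scheme \<Rightarrow> ('m \<Rightarrow> 'u) \<Rightarrow> 'o \<Rightarrow> ('o, 'm, 'u) set_functor" where
  "hom_functor C \<iota> A = \<lparr>FOb = (\<lambda>X. \<iota> ` Mor C A X),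
    FAr = (\<lambda>f u. \<iota> (f \<cdot>\<^bsub>C\<^esub> inv_into (Arr C) \<iota> u))\<rparr>"

definition filter_interp ::
  "('o, 'm, 'x) category_scheme \<Rightarrow> ('o, 'm, 'b) doctrine \<Rightarrow> ('m \<Rightarrow> 'u) \<Rightarrow> 'o \<Rightarrow> 'b set \<Rightarrow>
    'o \<Rightarrow> 'b \<Rightarrow> 'u set" where
  "filter_interp C P \<iota> A U X a = \<iota> ` {f \<in> Mor C A X. Rdx P f a \<in> U}"

lemma FOb_hom_functor: "FOb (hom_functor C \<iota> A) X = \<iota> ` Mor C A X"
  by (simp add: hom_functor_def)

lemma FAr_hom_functor:
  assumes "inj_on \<iota> (Arr C)" "h \<in> Mor C A X"
  shows "FAr (hom_functor C \<iota> A) f (\<iota> h) = \<iota> (f \<cdot>\<^bsub>C\<^esub> h)"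
  using assms by (simp add: hom_functor_def Mor_def)

lemma filter_interp_iff:
  assumes "inj_on \<iota> (Arr C)" "f \<in> Mor C A X"
  shows "\<iota> f \<in> filter_interp C P \<iota> A U X a \<longleftrightarrow> Rdx P f a \<in> U"
  using assms by (auto simp: filter_interp_def inj_on_def Mor_def)

lemma (in category) hom_functor_set_functor:
  assumes "inj_on \<iota> (Arr C)"
  shows "set_functor C (hom_functor C \<iota> A)"
proof (unfold_locales, goal_cases)
  case (1 f X Y)
  then show ?case using Cmp_in_Mor by (auto simp: FOb_hom_functor FAr_hom_functor[OF assms])
next
  case (2 X x)
  then show ?case by (auto simp: FOb_hom_functor FAr_hom_functor[OF assms] Idt_Cmp)
next
  case (3 f X Y g Z x)
  then obtain h where h: "x = \<iota> h" "h \<in> Mor C A X" by (auto simp: FOb_hom_functor)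
  with 3 Cmp_in_Mor[of h A X f Y] show ?case
    by (simp add: FAr_hom_functor[OF assms] Cmp_assoc)
qed

text \<open>The universal property of the product, tested on morphisms out of \<open>A\<close>, is
  the required bijection: uniqueness gives injectivity and existence gives surjectivity.\<close>

lemma (in category) hom_functor_preserves_finite_products:
  assumes \<iota>: "inj_on \<iota> (Arr C)" and A: "A \<in> Ob C"
  shows "preserves_finite_products C (hom_functor C \<iota> A)"
  unfolding preserves_finite_products_def
proof (intro allI impI)
  fix Xs B p
  assume "is_product C Xs B p"
  then have p: "\<And>k. k < length Xs \<Longrightarrow> p k \<in> Mor C B (Xs ! k)"
    and ex: "\<And>f. (\<And>k. k < length Xs \<Longrightarrow> f k \<in> Mor C A (Xs ! k)) \<Longrightarrow>
      \<exists>!h. h \<in> Mor C A B \<and> (\<forall>k<length Xs. p k \<cdot> h = f k)"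
    using A unfolding is_product_def by auto
  let ?M = "hom_functor C \<iota> A"
  let ?t = "\<lambda>x. map (\<lambda>k. FAr ?M (p k) x) [0..<length Xs]"
  have inj: "f = g" if "\<iota> f = \<iota> g" "f \<in> Mor C A X" "g \<in> Mor C A X" for f g X
    using \<iota> that by (auto simp: inj_on_def Mor_def)
  have t: "?t (\<iota> h) = map (\<lambda>k. \<iota> (p k \<cdot> h)) [0..<length Xs]" if "h \<in> Mor C A B" for h
    using FAr_hom_functor[OF \<iota> that] by simp
  have ls: "xs \<in> listset (map (FOb ?M) Xs) \<longleftrightarrow>
      length xs = length Xs \<and> (\<forall>k<length Xs. xs ! k \<in> \<iota> ` Mor C A (Xs ! k))" for xs
    by (auto simp: listset_iff_list_all2 list_all2_conv_all_nth FOb_hom_functor)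
  have ph: "p k \<cdot> h \<in> Mor C A (Xs ! k)" if "h \<in> Mor C A B" "k < length Xs" for h k
    using Cmp_in_Mor[OF that(1) p[OF that(2)]] .
  show "bij_betw ?t (FOb ?M B) (listset (map (FOb ?M) Xs))"
  proof (rule bij_betwI')
    fix x y assume "x \<in> FOb ?M B" "y \<in> FOb ?M B"
    then obtain h g where h: "x = \<iota> h" "h \<in> Mor C A B" and g: "y = \<iota> g" "g \<in> Mor C A B"
      by (auto simp: FOb_hom_functor)
    show "?t x = ?t y \<longleftrightarrow> x = y"
    proof
      assume "?t x = ?t y"
      then have "\<forall>k<length Xs. \<iota> (p k \<cdot> h) = \<iota> (p k \<cdot> g)" using h g t by simp
      then have "\<forall>k<length Xs. p k \<cdot> h = p k \<cdot> g" using inj ph h(2) g(2) by blast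
      \<comment> \<open>Both \<open>h\<close> and \<open>g\<close> factor the family
        \<open>p k \<cdot> h\<close> through the product.\<close>
      then have "h = g" using ex[of "\<lambda>k. p k \<cdot> h"] ph h(2) g(2) by metis
      then show "x = y" using h g by simp
    qed simp
  next
    fix x assume "x \<in> FOb ?M B"
    then obtain h where "x = \<iota> h" "h \<in> Mor C A B" by (auto simp: FOb_hom_functor)
    then show "?t x \<in> listset (map (FOb ?M) Xs)" using t ph by (simp add: ls)
  next
    fix xs assume "xs \<in> listset (map (FOb ?M) Xs)"
    then have len: "length xs = length Xs"
      and "\<forall>k. \<exists>f. k < length Xs \<longrightarrow> f \<in> Mor C A (Xs ! k) \<and> xs ! k = \<iota> f"
      unfolding ls by auto
    then obtain f where f: "\<And>k. k < length Xs \<Longrightarrow> f k \<in> Mor C A (Xs ! k) \<and> xs ! k = \<iota> (f k)"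
      by metis
    then obtain h where h: "h \<in> Mor C A B" "\<forall>k<length Xs. p k \<cdot> h = f k" using ex by blast
    have "xs = ?t (\<iota> h)"
      unfolding t[OF h(1)] by (rule nth_equalityI) (use f h(2) len in auto)
    moreover have "\<iota> h \<in> FOb ?M B" using h(1) by (simp add: FOb_hom_functor)
    ultimately show "\<exists>x\<in>FOb ?M B. xs = ?t x" by (rule bexI)
  qed
qed

lemma (in boolean_doctrine) Rdx_closed:
  "f \<in> Mor C X Y \<Longrightarrow> a \<in> carrier (Fib P Y) \<Longrightarrow> Rdx P f a \<in> carrier (Fib P X)"
  using Rdx_hom[of f X Y] by (auto simp: boolean_hom_def)

text \<open>Each \<open>Rdx P f\<close> is a Boolean homomorphism, so pulling \<open>U\<close> back
  along it respects the operations. Naturality is the functoriality of \<open>P\<close>: reindexing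
  along \<open>f \<cdot> h\<close> is reindexing along \<open>f\<close> and then along
  \<open>h\<close>.\<close>

lemma (in boolean_doctrine) filter_interp_nat_trans:
  assumes \<iota>: "inj_on \<iota> (Arr C)" and U: "prime_filter (Fib P A) U"
  shows "doctrine_nat_trans C P (subsets_doctrine C (hom_functor C \<iota> A)) (filter_interp C P \<iota> A U)"
proof -
  let ?M = "hom_functor C \<iota> A" and ?m = "filter_interp C P \<iota> A U"
  note m = filter_interp_iff[OF \<iota>]
  \<comment> \<open>Subsets of the encoded hom-set can be compared morphism by morphism, where
    \<open>m\<close> translates membership into membership in \<open>U\<close>.\<close>
  have eqI: "B = B'" if "B \<subseteq> \<iota> ` Mor C A X" "B' \<subseteq> \<iota> ` Mor C A X"
      "\<And>f. f \<in> Mor C A X \<Longrightarrow> \<iota> f \<in> B \<longleftrightarrow> \<iota> f \<in> B'" for B B' X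
    using that by blast
  have sub: "?m X a \<subseteq> \<iota> ` Mor C A X" for X a by (auto simp: filter_interp_def)
  have "boolean_hom (Fib P X) (Fib (subsets_doctrine C ?M) X) (?m X)" if X: "X \<in> Ob C" for X
  proof -
    interpret L: boolean_lattice "Fib P X" using Fib_boolean X .
    have R: "Rdx P f \<top>\<^bsub>Fib P X\<^esub> \<in> U" "Rdx P f \<bottom>\<^bsub>Fib P X\<^esub> \<notin> U"
      if "f \<in> Mor C A X" for f
      using Rdx_hom[OF that] U by (simp_all add: boolean_hom_def prime_filter_def)
    have Q: "Rdx P f (x \<sqinter>\<^bsub>Fib P X\<^esub> y) \<in> U \<longleftrightarrow> Rdx P f x \<in> U \<and> Rdx P f y \<in> U"
      "Rdx P f (x \<squnion>\<^bsub>Fib P X\<^esub> y) \<in> U \<longleftrightarrow> Rdx P f x \<in> U \<or> Rdx P f y \<in> U"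
      if "f \<in> Mor C A X" "x \<in> carrier (Fib P X)" "y \<in> carrier (Fib P X)" for f x y
      using Rdx_hom[OF that(1)] Rdx_closed[OF that(1)] that(2,3) U
      by (simp_all add: boolean_hom_def prime_filter_def meet_pres_def join_pres_def)
    have "?m X (x \<sqinter>\<^bsub>Fib P X\<^esub> y) = ?m X x \<inter> ?m X y"
      "?m X (x \<squnion>\<^bsub>Fib P X\<^esub> y) = ?m X x \<union> ?m X y"
      if "x \<in> carrier (Fib P X)" "y \<in> carrier (Fib P X)" for x y
      using sub[of X x] sub[of X y] Q[OF _ that] by (intro eqI[OF sub]; auto simp: m)+
    moreover have "?m X \<top>\<^bsub>Fib P X\<^esub> = \<iota> ` Mor C A X" "?m X \<bottom>\<^bsub>Fib P X\<^esub> = {}"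
      using R by (auto simp: filter_interp_def)
    moreover note pow = powerset_boolean_lattice[of "\<iota> ` Mor C A X"]
    moreover have "lattice \<lparr>carrier = Pow (\<iota> ` Mor C A X), eq = (=), le = (\<subseteq>)\<rparr>"
      using pow boolean_lattice.axioms(1) bounded_lattice.axioms(1) by blast
    ultimately show ?thesis
      using Fib_boolean[OF X] sub L.lattice_axioms
      by (simp add: boolean_hom_def meet_pres_def join_pres_def subsets_doctrine_def
        FOb_hom_functor powerset_meet[OF sub sub] powerset_join[OF sub sub] powerset_top
        powerset_bottom)
  qed
  moreover have "?m X (Rdx P f a) = Rdx (subsets_doctrine C ?M) f (?m Y a)"
    if f: "f \<in> Mor C X Y" and a: "a \<in> carrier (Fib P Y)" for X Y f a
  proof -
    have dom: "Dom C f = X" using f by (simp add: Mor_def)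
    have "\<iota> (f \<cdot> h) \<in> ?m Y a \<longleftrightarrow> \<iota> h \<in> ?m X (Rdx P f a)" if h: "h \<in> Mor C A X" for h
      using Rdx_Cmp[OF h f a] by (simp add: m[OF h] m[OF Cmp_in_Mor[OF h f]])
    then show ?thesis
      by (intro eqI[OF sub])
        (auto simp: subsets_doctrine_def FOb_hom_functor dom FAr_hom_functor[OF \<iota>])
  qed
  ultimately show ?thesis unfolding doctrine_nat_trans_def by blast
qed

lemma (in boolean_doctrine) hom_functor_propositional_model:
  assumes "inj_on \<iota> (Arr C)" "A \<in> Ob C" "prime_filter (Fib P A) U"
  shows "propositional_model C P (hom_functor C \<iota> A) (filter_interp C P \<iota> A U)"
  unfolding propositional_model_def
  using assms hom_functor_set_functor hom_functor_preserves_finite_products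
    filter_interp_nat_trans by blast


section \<open>The two implications between the inequality and the condition on models\<close>

text \<open>Suppose every \<open>\<beta> j\<close> fails at some \<open>z j\<close>. Then
  \<open>s\<close> and the \<open>z j\<close> form a point \<open>w\<close> of \<open>M\<close> at
  the product of \<open>W\<close>. All the instances of the \<open>\<alpha> i\<close> hold at
  \<open>w\<close>, so the inequality makes some instance of a \<open>\<beta> j\<close> hold there,
  which contradicts the choice of \<open>z j\<close>.\<close>

lemma (in boolean_doctrine) instances_le_imp_model_condition:
  fixes n :: nat
  assumes M: "propositional_model_at C P S M m s"
    and S: "S \<in> Ob C"
    and Z: "\<And>j. j < J \<Longrightarrow> Z j \<in> Ob C"
    and \<alpha>: "\<And>i. i < I \<Longrightarrow> \<alpha> i \<in> carrier (Fib P (Prd C [S, Y i]))"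
    and \<beta>: "\<And>j. j < J \<Longrightarrow> \<beta> j \<in> carrier (Fib P (Prd C [S, Z j]))"
    and W: "W = S # map Z [0..<J]"
    and g: "\<And>k. k < n \<Longrightarrow> l k < I \<and> g k \<in> Mor C (Prd C W) (Y (l k))"
    and le: "(IINF\<^bsub>Fib P (Prd C W)\<^esub> k:{..<n}. Rdx P (pairing C (Pr C W 0) (g k)) (\<alpha> (l k)))
          \<sqsubseteq>\<^bsub>Fib P (Prd C W)\<^esub>
        (SSUP\<^bsub>Fib P (Prd C W)\<^esub> j:{..<J}. Rdx P (pairing C (Pr C W 0) (Pr C W (Suc j))) (\<beta> j))"
    and hyp: "\<And>i y. i < I \<Longrightarrow> y \<in> FOb M (Y i) \<Longrightarrow>
      model_pair C M S (Y i) s y \<in> m (Prd C [S, Y i]) (\<alpha> i)"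
  shows "\<exists>j<J. \<forall>z\<in>FOb M (Z j). model_pair C M S (Z j) s z \<in> m (Prd C [S, Z j]) (\<beta> j)"
proof (rule ccontr)
  assume "\<not> ?thesis"
  then have "\<forall>j. \<exists>z. j < J \<longrightarrow> z \<in> FOb M (Z j) \<and>
      model_pair C M S (Z j) s z \<notin> m (Prd C [S, Z j]) (\<beta> j)" by blast
  then obtain z where z: "\<And>j. j < J \<Longrightarrow> z j \<in> FOb M (Z j)"
      "\<And>j. j < J \<Longrightarrow> model_pair C M S (Z j) s (z j) \<notin> m (Prd C [S, Z j]) (\<beta> j)"
    by metis
  have m: "propositional_model C P M m" and s: "s \<in> FOb M S"
    using M by (auto simp: propositional_model_at_def)
  then have sf: "set_functor C M" and fp: "preserves_finite_products C M"
    by (auto simp: propositional_model_def)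
  interpret set_functor C M by fact
  let ?A = "Prd C W"
  let ?L = "Fib P ?A"
  have W_Ob: "set W \<subseteq> Ob C" using S Z W by auto
  have A: "?A \<in> Ob C" using Prd_is_product[OF W_Ob] by (simp add: is_product_def)
  interpret L: boolean_lattice ?L using Fib_boolean[OF A] .
  have W_nth: "length W = Suc J" "W ! 0 = S" "\<And>j. j < J \<Longrightarrow> W ! Suc j = Z j" by (simp_all add: W)
  have p0: "Pr C W 0 \<in> Mor C ?A S" using Pr_in_Mor[OF W_Ob, of 0] W_nth by simp
  have pS: "Pr C W (Suc j) \<in> Mor C ?A (Z j)" if "j < J" for j
    using Pr_in_Mor[OF W_Ob, of "Suc j"] W_nth that by simp
  have "bij_betw (\<lambda>x. map (\<lambda>k. FAr M (Pr C W k) x) [0..<length W])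
      (FOb M ?A) (listset (map (FOb M) W))"
    using fp Prd_is_product[OF W_Ob] unfolding preserves_finite_products_def by blast
  \<comment> \<open>This list has a preimage \<open>w\<close> because \<open>M\<close> preserves the
    product of \<open>W\<close>.\<close>
  moreover have "s # map z [0..<J] \<in> listset (map (FOb M) W)"
    unfolding listset_iff_list_all2 W using s z(1)
    by (simp add: list_all2_conv_all_nth All_less_Suc2)
  ultimately obtain w where w: "w \<in> FOb M ?A"
    and eq: "map (\<lambda>k. FAr M (Pr C W k) w) [0..<length W] = s # map z [0..<J]"
    by (metis (no_types, lifting) bij_betw_imp_surj_on imageE)
  \<comment> \<open>Coordinate 0 of \<open>w\<close> is \<open>s\<close> and coordinate
    \<open>Suc j\<close> is \<open>z j\<close>: the factor \<open>S\<close> shifts the indices of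
    the \<open>Z j\<close> by one.\<close>
  have proj: "FAr M (Pr C W k) w = (s # map z [0..<J]) ! k" if "k < Suc J" for k
    using arg_cong[OF eq, of "\<lambda>xs. xs ! k"] that W_nth(1) by (simp del: upt_Suc)
  have ws: "FAr M (Pr C W 0) w = s" using proj[of 0] by simp
  have wz: "FAr M (Pr C W (Suc j)) w = z j" if "j < J" for j
    using proj[of "Suc j"] that by simp
  let ?U = "{a \<in> carrier ?L. w \<in> m ?A a}"
  have U: "prime_filter ?L ?U" using propositional_model_point_filter[OF m A w] .
  \<comment> \<open>A reindexed element \<open>a\<close> holds at \<open>w\<close> exactly when the
    pair of \<open>s\<close> and \<open>FAr M f w\<close> satisfies \<open>a\<close>. It is used
    with \<open>f = g k\<close> for the \<open>\<alpha>\<close> and with \<open>f\<close> a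
    projection for the \<open>\<beta>\<close>.\<close>
  have inst: "Rdx P (pairing C (Pr C W 0) f) a \<in> carrier ?L \<and>
      (Rdx P (pairing C (Pr C W 0) f) a \<in> ?U \<longleftrightarrow>
        model_pair C M S X s (FAr M f w) \<in> m (Prd C [S, X]) a)"
    if f: "f \<in> Mor C ?A X" and a: "a \<in> carrier (Fib P (Prd C [S, X]))" for f X a
    using Rdx_closed[OF pairing_in_Mor[OF p0 f] a]
      propositional_model_Rdx_iff[OF m pairing_in_Mor[OF p0 f] a w]
      model_pair_FAr[OF sf fp p0 f w] ws by simp
  let ?a = "\<lambda>k. Rdx P (pairing C (Pr C W 0) (g k)) (\<alpha> (l k))"
  let ?b = "\<lambda>j. Rdx P (pairing C (Pr C W 0) (Pr C W (Suc j))) (\<beta> j)"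
  have a: "?a ` {..<n} \<subseteq> ?U"
  proof (intro image_subsetI)
    fix k assume "k \<in> {..<n}"
    then have k: "l k < I" "g k \<in> Mor C ?A (Y (l k))" using g by auto
    then have "FAr M (g k) w \<in> FOb M (Y (l k))" using FAr_fun w by blast
    with inst[OF k(2) \<alpha>[OF k(1)]] hyp[OF k(1)] show "?a k \<in> ?U" by blast
  qed
  have b: "?b ` {..<J} \<subseteq> carrier ?L" "?b ` {..<J} \<inter> ?U = {}"
    using inst[OF pS \<beta>] z(2) wz by auto
  have aL: "?a ` {..<n} \<subseteq> carrier ?L" using a by blast
  \<comment> \<open>The finite meet lies in the filter of \<open>w\<close>, so by \<open>le\<close>
    the join does; primeness would then put some member of the join into the filter.\<close>
  have "infi ?L {..<n} ?a \<in> ?U"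
    unfolding infi_def by (rule iffD2[OF L.prime_filter_inf_iff[OF U _ aL] a]) simp
  moreover have "supr ?L {..<J} ?b \<in> carrier ?L"
    using L.finite_sup_is_lub[of "?b ` {..<J}"] b(1) by (auto simp: supr_def)
  ultimately have "supr ?L {..<J} ?b \<in> ?U" using L.prime_filter_up[OF U _ _ le] by blast
  then show False
    using L.prime_filter_sup_iff[OF U, of "?b ` {..<J}"] b by (simp add: supr_def)
qed

text \<open>By contraposition a single model suffices: the one on the functor represented by the
  product of \<open>W\<close>, built from a prime filter that separates the instances of the
  \<open>\<alpha> i\<close> from the join of the \<open>\<beta> j\<close>.\<close>

lemma (in boolean_doctrine) model_condition_imp_instances_le:
  fixes \<iota> :: "'m \<Rightarrow> 'u"
  assumes \<iota>: "inj_on \<iota> (Arr C)"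
    and S: "S \<in> Ob C"
    and Z: "\<And>j. j < J \<Longrightarrow> Z j \<in> Ob C"
    and \<alpha>: "\<And>i. i < I \<Longrightarrow> \<alpha> i \<in> carrier (Fib P (Prd C [S, Y i]))"
    and \<beta>: "\<And>j. j < J \<Longrightarrow> \<beta> j \<in> carrier (Fib P (Prd C [S, Z j]))"
    and W: "W = S # map Z [0..<J]"
    and models: "\<And>(M :: ('o, 'm, 'u) set_functor) m s. propositional_model_at C P S M m s \<Longrightarrow>
      (\<And>i y. i < I \<Longrightarrow> y \<in> FOb M (Y i) \<Longrightarrow>
        model_pair C M S (Y i) s y \<in> m (Prd C [S, Y i]) (\<alpha> i)) \<Longrightarrow>
      \<exists>j<J. \<forall>z\<in>FOb M (Z j). model_pair C M S (Z j) s z \<in> m (Prd C [S, Z j]) (\<beta> j)"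
  shows "\<exists>(n :: nat) l g. (\<forall>k<n. l k < I \<and> g k \<in> Mor C (Prd C W) (Y (l k))) \<and>
      (IINF\<^bsub>Fib P (Prd C W)\<^esub> k:{..<n}. Rdx P (pairing C (Pr C W 0) (g k)) (\<alpha> (l k)))
          \<sqsubseteq>\<^bsub>Fib P (Prd C W)\<^esub>
        (SSUP\<^bsub>Fib P (Prd C W)\<^esub> j:{..<J}. Rdx P (pairing C (Pr C W 0) (Pr C W (Suc j))) (\<beta> j))"
proof (rule ccontr)
  assume no: "\<not> ?thesis"
  let ?A = "Prd C W"
  let ?L = "Fib P ?A"
  have W_Ob: "set W \<subseteq> Ob C" using S Z W by auto
  have A: "?A \<in> Ob C" using Prd_is_product[OF W_Ob] by (simp add: is_product_def)
  interpret L: boolean_lattice ?L using Fib_boolean[OF A] .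
  have W_nth: "length W = Suc J" "W ! 0 = S" "\<And>j. j < J \<Longrightarrow> W ! Suc j = Z j" by (simp_all add: W)
  have p0: "Pr C W 0 \<in> Mor C ?A S" using Pr_in_Mor[OF W_Ob, of 0] W_nth by simp
  have pS: "Pr C W (Suc j) \<in> Mor C ?A (Z j)" if "j < J" for j
    using Pr_in_Mor[OF W_Ob, of "Suc j"] W_nth that by simp
  let ?r = "\<lambda>f. Rdx P (pairing C (Pr C W 0) f)"
  have r: "?r f a \<in> carrier ?L"
    if "f \<in> Mor C ?A X" "a \<in> carrier (Fib P (Prd C [S, X]))" for f X a
    using Rdx_closed[OF pairing_in_Mor[OF p0 that(1)] that(2)] .
  \<comment> \<open>The instances along every morphism into every \<open>Y i\<close>, since the
    points of \<open>Y i\<close> in the representable model are exactly these morphisms.\<close>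
  let ?G = "{?r f (\<alpha> i) | i f. i < I \<and> f \<in> Mor C ?A (Y i)}"
  let ?B = "(\<lambda>j. ?r (Pr C W (Suc j)) (\<beta> j)) ` {..<J}"
  have G: "?G \<subseteq> carrier ?L" using r \<alpha> by blast
  have B: "?B \<subseteq> carrier ?L" using r[OF pS \<beta>] by auto
  have b: "\<Squnion>\<^bsub>?L\<^esub>?B \<in> carrier ?L" using L.finite_sup_is_lub[OF _ B] by auto
  have sep: "\<not> \<Sqinter>\<^bsub>?L\<^esub>F \<sqsubseteq>\<^bsub>?L\<^esub> \<Squnion>\<^bsub>?L\<^esub>?B" if F: "finite F" "F \<subseteq> ?G" for F
  proof
    assume le: "\<Sqinter>\<^bsub>?L\<^esub>F \<sqsubseteq>\<^bsub>?L\<^esub> \<Squnion>\<^bsub>?L\<^esub>?B"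
    \<comment> \<open>Enumerating a finite set of instances supplies the witnesses \<open>n\<close>,
      \<open>l\<close> and \<open>g\<close> that were assumed not to exist; the empty set gives
      \<open>n = 0\<close>.\<close>
    obtain n :: nat and e where e: "F = e ` {k. k < n}"
      using finite_imp_nat_seg_image_inj_on[OF F(1)] by blast
    have "\<forall>k. \<exists>i f. k < n \<longrightarrow> i < I \<and> f \<in> Mor C ?A (Y i) \<and> e k = ?r f (\<alpha> i)"
      using F(2) unfolding e by blast
    then obtain l g where lg: "\<And>k. k < n \<Longrightarrow>
        l k < I \<and> g k \<in> Mor C ?A (Y (l k)) \<and> e k = ?r (g k) (\<alpha> (l k))"
      by metis
    have "F = (\<lambda>k. ?r (g k) (\<alpha> (l k))) ` {..<n}" unfolding e using lg by (intro image_cong) auto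
    with le lg have "(\<forall>k<n. l k < I \<and> g k \<in> Mor C ?A (Y (l k))) \<and>
        infi ?L {..<n} (\<lambda>k. ?r (g k) (\<alpha> (l k))) \<sqsubseteq>\<^bsub>?L\<^esub>
        supr ?L {..<J} (\<lambda>j. ?r (Pr C W (Suc j)) (\<beta> j))"
      by (simp add: infi_def supr_def)
    with no show False by blast
  qed
  obtain U where U: "prime_filter ?L U" and GU: "?G \<subseteq> U" and "\<Squnion>\<^bsub>?L\<^esub>?B \<notin> U"
    by (rule L.prime_filter_exists[OF G b sep])
  \<comment> \<open>Since the join is outside the prime filter, so is every joinand.\<close>
  with L.prime_filter_sup_iff[OF U _ B] have BU: "?B \<inter> U = {}" by auto
  let ?M = "hom_functor C \<iota> ?A" and ?m = "filter_interp C P \<iota> ?A U"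
  have m: "propositional_model C P ?M ?m"
    using hom_functor_propositional_model[OF \<iota> A U] .
  then have at: "propositional_model_at C P S ?M ?m (\<iota> (Pr C W 0))"
    using p0 by (simp add: propositional_model_at_def FOb_hom_functor)
  have pair: "model_pair C ?M S X (\<iota> (Pr C W 0)) (\<iota> f) \<in> ?m (Prd C [S, X]) a \<longleftrightarrow> ?r f a \<in> U"
    if f: "f \<in> Mor C ?A X" for f X a
  proof -
    note fg = pairing_in_Mor[OF p0 f]
    \<comment> \<open>The identity is the generic point: every morphism \<open>h\<close> out of
      \<open>?A\<close> is its image under \<open>FAr ?M h\<close>. Thus
      \<open>model_pair_FAr\<close> at this point computes the pair of any two encoded
      morphisms.\<close>
    have eval: "FAr ?M h (\<iota> (Idt C ?A)) = \<iota> h" if "h \<in> Mor C ?A X" for h X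
      using FAr_hom_functor[OF \<iota> Idt_in_Mor[OF A]] Cmp_Idt[OF that] by simp
    have "\<iota> (Idt C ?A) \<in> FOb ?M ?A" using Idt_in_Mor[OF A] by (simp add: FOb_hom_functor)
    then have "model_pair C ?M S X (\<iota> (Pr C W 0)) (\<iota> f) = \<iota> (pairing C (Pr C W 0) f)"
      using m model_pair_FAr[OF _ _ p0 f, of ?M "\<iota> (Idt C ?A)"] eval[OF p0] eval[OF f] eval[OF fg]
      by (simp add: propositional_model_def)
    then show ?thesis using filter_interp_iff[OF \<iota> fg] by simp
  qed
  have "model_pair C ?M S (Y i) (\<iota> (Pr C W 0)) y \<in> ?m (Prd C [S, Y i]) (\<alpha> i)"
    if i: "i < I" and y: "y \<in> FOb ?M (Y i)" for i y
  proof -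
    \<comment> \<open>A point of \<open>Y i\<close> is a morphism \<open>f\<close>, and the
      corresponding instance of \<open>\<alpha> i\<close> is in \<open>?G\<close>, hence in
      \<open>U\<close>.\<close>
    obtain f where f: "y = \<iota> f" "f \<in> Mor C ?A (Y i)" using y by (auto simp: FOb_hom_functor)
    with i GU have "?r f (\<alpha> i) \<in> U" by blast
    with f pair show ?thesis by simp
  qed
  from models[OF at this] obtain j where j: "j < J"
    and all: "\<forall>z\<in>FOb ?M (Z j). model_pair C ?M S (Z j) (\<iota> (Pr C W 0)) z \<in> ?m (Prd C [S, Z j]) (\<beta> j)"
    by blast
  \<comment> \<open>The projection onto \<open>Z j\<close> is the counterexample, as its instance of
    \<open>\<beta> j\<close> is in \<open>?B\<close> and so outside \<open>U\<close>.\<close>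
  have "\<iota> (Pr C W (Suc j)) \<in> FOb ?M (Z j)" using pS[OF j] by (simp add: FOb_hom_functor)
  with all have "?r (Pr C W (Suc j)) (\<beta> j) \<in> U" using pair[OF pS[OF j]] by blast
  with BU j show False by blast
qed

theorem theorem3p35:
  fixes C :: "('o, 'm) fp_category"
    and P :: "('o, 'm, 'b) doctrine"
    and I J :: nat
    and S :: 'o
    and Y Z :: "nat \<Rightarrow> 'o"
    and \<alpha> \<beta> :: "nat \<Rightarrow> 'b"
  defines "W \<equiv> S # map Z [0..<J]"
  assumes "boolean_doctrine C P"
    and "small TYPE('u) C"
    and "S \<in> Ob C"
    and "\<And>i. i < I \<Longrightarrow> Y i \<in> Ob C"
    and "\<And>j. j < J \<Longrightarrow> Z j \<in> Ob C"
    and "\<And>i. i < I \<Longrightarrow> \<alpha> i \<in> carrier (Fib P (Prd C [S, Y i]))"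
    and "\<And>j. j < J \<Longrightarrow> \<beta> j \<in> carrier (Fib P (Prd C [S, Z j]))"
  shows
    "(\<forall>(M :: ('o, 'm, 'u) set_functor) m s.
        propositional_model_at C P S M m s \<longrightarrow>
        (\<forall>i<I. \<forall>y\<in>FOb M (Y i). model_pair C M S (Y i) s y \<in> m (Prd C [S, Y i]) (\<alpha> i)) \<longrightarrow>
        (\<exists>j<J. \<forall>z\<in>FOb M (Z j). model_pair C M S (Z j) s z \<in> m (Prd C [S, Z j]) (\<beta> j)))
     \<longleftrightarrow>
     (\<exists>(n :: nat) (l :: nat \<Rightarrow> nat) (g :: nat \<Rightarrow> 'm).
        (\<forall>k<n. l k < I \<and> g k \<in> Mor C (Prd C W) (Y (l k))) \<and>
        (IINF\<^bsub>Fib P (Prd C W)\<^esub> k:{..<n}. Rdx P (pairing C (Pr C W 0) (g k)) (\<alpha> (l k)))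
          \<sqsubseteq>\<^bsub>Fib P (Prd C W)\<^esub>
        (SSUP\<^bsub>Fib P (Prd C W)\<^esub> j:{..<J}. Rdx P (pairing C (Pr C W 0) (Pr C W (Suc j))) (\<beta> j)))"
proof -
  interpret boolean_doctrine C P by fact
  obtain \<iota> :: "'m \<Rightarrow> 'u" where \<iota>: "inj_on \<iota> (Arr C)" using assms(3) by (auto simp: small_def)
  have W: "W = S # map Z [0..<J]" by (simp add: W_def)
  show ?thesis (is "?models \<longleftrightarrow> ?instances")
  proof
    assume ?models
    then show ?instances
      by (intro model_condition_imp_instances_le[OF \<iota> assms(4,6-8) W]) blast+
  next
    assume ?instances
    then show ?models
    proof (elim exE conjE, intro allI impI)
      fix n :: nat and l g and M :: "('o, 'm, 'u) set_functor" and m s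
      assume g: "\<forall>k<n. l k < I \<and> g k \<in> Mor C (Prd C W) (Y (l k))"
        and le: "(IINF\<^bsub>Fib P (Prd C W)\<^esub> k:{..<n}. Rdx P (pairing C (Pr C W 0) (g k)) (\<alpha> (l k)))
            \<sqsubseteq>\<^bsub>Fib P (Prd C W)\<^esub>
          (SSUP\<^bsub>Fib P (Prd C W)\<^esub> j:{..<J}. Rdx P (pairing C (Pr C W 0) (Pr C W (Suc j))) (\<beta> j))"
        and M: "propositional_model_at C P S M m s"
        and hyp: "\<forall>i<I. \<forall>y\<in>FOb M (Y i). model_pair C M S (Y i) s y \<in> m (Prd C [S, Y i]) (\<alpha> i)"
      show "\<exists>j<J. \<forall>z\<in>FOb M (Z j). model_pair C M S (Z j) s z \<in> m (Prd C [S, Z j]) (\<beta> j)"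
        by (rule instances_le_imp_model_condition[OF M assms(4,6-8) W g[rule_format] le])
          (use hyp in auto)
    qed
  qed
qed

end
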